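(* For the sparse Erdős–Rényi random graph $\mathrm{ERRG}(n,\frac\lambda n)$, with triangle friendship-bias $\Delta^T_{[n]}$, the following hold: (a) For every $\lambda\in(0,\infty)$ and every integer $n\ge3$ with $n\ge\lambda$, $$\mathbb E\big[\Delta^T_{[n]}\big]=\tfrac\lambda n\big(1-\tfrac\lambda n\big)\big[\tfrac\lambda n(n-2)-1\big]+\Big[\tfrac\lambda n-\big(\tfrac\lambda n\big)^3\tfrac12(n-2)(n-3)\Big]\big(1-\tfrac\lambda n\big)^{n-1}.$$ (b) For every $\lambda\in(0,\infty)$, $$\lim_{n\to\infty}\mathbb E\big[n\Delta^T_{[n]}\big]=\zeta(\lambda),\qquad \zeta(\lambda)=\lambda^2-\lambda+\big[\lambda-\tfrac12\lambda^3\big]e^{-\lambda}.$$ (c) For every $\lambda\in(0,\infty)$, $$\liminf_{n\to\infty}\mathbb P\big(n\Delta^T_{[n]}=0\big)>0,$$ and because of this the weak law of large numbers fails for $n\Delta^T_{[n]}$ (i.e. $n\Delta^T_{[n]}$ does not converge in probability to $\zeta(\lambda)$).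
   Context: $\mathrm{ERRG}(n,\frac\lambda n)$, with $\lambda\in(0,\infty)$ and $n\ge\lambda$, is the random graph on vertex set $[n]=\{1,\dots,n\}$ obtained from the complete graph $K_n$ by independently deleting each edge with probability $1-\frac\lambda n$ (so each edge is retained with probability $\frac\lambda n\in(0,1]$). $\mathbb P$ and $\mathbb E$ denote the corresponding probability and expectation. Triangle friendship-bias. For a finite graph on $[n]$ with adjacency matrix $(A_{ij})$, degrees $d_i=\sum_jA_{ij}$, and $t_i$ the number of triangles containing $i$, $$\Delta^T_{i,n}=\Big[\frac1{d_i}\sum_{j\in[n]}A_{ij}t_j-t_i\Big]\mathbf 1_{\{d_i\ne0\}},\qquad \Delta^T_{[n]}=\frac1n\sum_{i\in[n]}\Delta^T_{i,n}.$$ *)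

theory Defs
  imports "HOL-Probability.Probability" "HOL-Library.Ramsey"
begin

text \<open>
  A simple graph on the vertex set \<open>{1..n}\<close> is represented by its edge set, a subset of
  \<open>[{1..n}]\<^bsup>2\<^esup>\<close>, the set of all two-element subsets of \<open>{1..n}\<close>.
\<close>

type_synonym graph = "nat set set"

definition adj :: "graph \<Rightarrow> nat \<Rightarrow> nat \<Rightarrow> real" where
  "adj E i j = of_bool ({i, j} \<in> E)"

definition deg :: "nat \<Rightarrow> graph \<Rightarrow> nat \<Rightarrow> real" where
  "deg n E i = (\<Sum>j\<in>{1..n}. adj E i j)"

text \<open>A triangle is a set of three vertices all of whose pairs are edges.\<close>

definition triangles :: "nat \<Rightarrow> graph \<Rightarrow> nat set set" where
  "triangles n E = {T \<in> [{1..n}]\<^bsup>3\<^esup>. [T]\<^bsup>2\<^esup> \<subseteq> E}"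

definition triangles_at :: "nat \<Rightarrow> graph \<Rightarrow> nat \<Rightarrow> real" where
  "triangles_at n E i = real (card {T \<in> triangles n E. i \<in> T})"

definition triangle_bias_at :: "nat \<Rightarrow> graph \<Rightarrow> nat \<Rightarrow> real" where
  "triangle_bias_at n E i =
     (1 / deg n E i * (\<Sum>j\<in>{1..n}. adj E i j * triangles_at n E j) - triangles_at n E i)
     * of_bool (deg n E i \<noteq> 0)"

definition triangle_bias :: "nat \<Rightarrow> graph \<Rightarrow> real" where
  "triangle_bias n E = 1 / real n * (\<Sum>i\<in>{1..n}. triangle_bias_at n E i)"

text \<open>
  Each edge of the complete graph on \<open>{1..n}\<close> is retained independently with probability \<open>p\<close>.
  Only \<open>0 \<le> p \<le> 1\<close> is meaningful (\<^const>\<open>bernoulli_pmf\<close> clips its parameter to this range).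
\<close>

definition ERRG :: "nat \<Rightarrow> real \<Rightarrow> graph pmf" where
  "ERRG n p = map_pmf (\<lambda>retained. {e \<in> [{1..n}]\<^bsup>2\<^esup>. retained e})
     (Pi_pmf ([{1..n}]\<^bsup>2\<^esup>) False (\<lambda>_. bernoulli_pmf p))"

text \<open>
  Convergence in probability to a constant; the \<open>X n\<close> may live on different probability spaces.
\<close>

definition converges_in_prob :: "(nat \<Rightarrow> 'a pmf) \<Rightarrow> (nat \<Rightarrow> 'a \<Rightarrow> real) \<Rightarrow> real \<Rightarrow> bool" where
  "converges_in_prob M X c \<longleftrightarrow>
     (\<forall>\<epsilon>>0. (\<lambda>n. measure_pmf.prob (M n) {x. \<bar>X n x - c\<bar> > \<epsilon>}) \<longlonglongrightarrow> 0)"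

definition zeta :: "real \<Rightarrow> real" where
  "zeta l = l ^ 2 - l + (l - 1 / 2 * l ^ 3) * exp (- l)"

end

theory Submission
  imports Defs "HOL-Real_Asymp.Real_Asymp"
begin

text \<open>
  The bias at a vertex \<open>i\<close> is computed by conditioning on the edges at \<open>i\<close>. Given that \<open>i\<close> has \<open>d > 0\<close> neighbours,
  the edges that avoid \<open>i\<close> are still independent. Among the triangles at the neighbours, those through \<open>i\<close> are
  the edges between neighbours, each counted twice, which contributes \<open>2 * p * (d choose 2)\<close> on average. Those
  avoiding \<open>i\<close> contribute \<open>d * c\<close> with \<open>c = p ^ 3 * ((n - 2) choose 2)\<close>. Dividing by \<open>d\<close> leaves
  \<open>p * (d - 1) + c\<close>, so that no reciprocal of the degree survives, and only the mean of \<open>d\<close> and the probability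
  \<open>(1 - p) ^ (n - 1)\<close> of isolation enter the unconditional mean. Subtracting the mean number
  \<open>p ^ 3 * ((n - 1) choose 2)\<close> of triangles at \<open>i\<close> gives the same value for every \<open>i\<close>, hence also for the average
  over \<open>i\<close>; this is \<open>mean_triangle_bias_at\<close>, and the limit \<open>zeta l\<close> follows by setting \<open>p = l / n\<close>.

  The weak law fails because the bias has an atom at \<open>0\<close> that does not vanish. The bias of a triangle-free graph is
  \<open>0\<close>. Being free of a given triangle is a decreasing event, so by Harris' inequality (\<open>Harris_inequality\<close>) the
  probability that there is no triangle at all is at least \<open>(1 - p ^ 3) ^ (n choose 3)\<close>, which stays bounded away
  from \<open>0\<close> for \<open>p = l / n\<close>. On the other hand \<open>zeta l\<close> is strictly positive (\<open>zeta_pos\<close>), so an atom at \<open>0\<close> is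
  incompatible with convergence in probability to \<open>zeta l\<close>.

  The random edge set is handled through \<open>subset_mean\<close>, the mean over a random subset, which satisfies a simple
  recursion over the ground set and a version of Fubini's theorem for disjoint unions.
\<close>

section \<open>Means over random subsets\<close>

text \<open>
  The expectation of \<open>f\<close> over a random subset of \<open>S\<close> that contains each element independently
  with probability \<open>p\<close>. A plain finite sum needs no integrability side conditions, and its linearity and
  recursion over \<open>S\<close> hold for every real \<open>p\<close>.
\<close>
definition subset_mean :: "real \<Rightarrow> 'a set \<Rightarrow> ('a set \<Rightarrow> real) \<Rightarrow> real" where
  "subset_mean p S f = (\<Sum>A\<in>Pow S. p ^ card A * (1 - p) ^ card (S - A) * f A)"

lemma subset_mean_empty [simp]: "subset_mean p {} f = f {}"
  by (simp add: subset_mean_def)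

text \<open>
  Conditioning on whether \<open>e\<close> is chosen; this recursion drives the inductions over \<open>S\<close> below.
\<close>
lemma subset_mean_insert:
  assumes "finite S" "e \<notin> S"
  shows "subset_mean p (insert e S) f =
    (1 - p) * subset_mean p S f + p * subset_mean p S (\<lambda>A. f (insert e A))"
proof -
  have disj: "Pow S \<inter> insert e ` Pow S = {}" and inj: "inj_on (insert e) (Pow S)"
    using \<open>e \<notin> S\<close> by (auto simp: inj_on_def)
  have w: "p ^ card A * (1 - p) ^ card (insert e S - A) = (1 - p) * (p ^ card A * (1 - p) ^ card (S - A))"
    "p ^ card (insert e A) * (1 - p) ^ card (insert e S - insert e A) =
      p * (p ^ card A * (1 - p) ^ card (S - A))" if "A \<in> Pow S" for A
  proof -
    have A: "finite A" "e \<notin> A" using that assms finite_subset by auto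
    moreover have "insert e S - A = insert e (S - A)" "insert e S - insert e A = S - A"
      using that assms by auto
    ultimately show "p ^ card A * (1 - p) ^ card (insert e S - A) = (1 - p) * (p ^ card A * (1 - p) ^ card (S - A))"
      "p ^ card (insert e A) * (1 - p) ^ card (insert e S - insert e A) =
        p * (p ^ card A * (1 - p) ^ card (S - A))" using assms by simp_all
  qed
  have "(\<Sum>A\<in>Pow S. p ^ card A * (1 - p) ^ card (insert e S - A) * f A) = (1 - p) * subset_mean p S f"
    unfolding subset_mean_def sum_distrib_left
    by (intro sum.cong) (simp_all only: w mult.assoc)
  moreover have "(\<Sum>A\<in>insert e ` Pow S. p ^ card A * (1 - p) ^ card (insert e S - A) * f A)
      = p * subset_mean p S (\<lambda>A. f (insert e A))"
    unfolding subset_mean_def sum_distrib_left sum.reindex[OF inj] o_def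
    by (intro sum.cong) (simp_all only: w mult.assoc)
  ultimately show ?thesis
    unfolding subset_mean_def Pow_insert using \<open>finite S\<close> disj
    by (subst sum.union_disjoint) simp_all
qed

lemma subset_mean_cong:
  assumes "\<And>A. A \<subseteq> S \<Longrightarrow> f A = g A"
  shows "subset_mean p S f = subset_mean p S g"
  using assms by (simp add: subset_mean_def)

lemma subset_mean_add: "subset_mean p S (\<lambda>A. f A + g A) = subset_mean p S f + subset_mean p S g"
  by (simp add: subset_mean_def algebra_simps sum.distrib)

lemma subset_mean_cmult: "subset_mean p S (\<lambda>A. c * f A) = c * subset_mean p S f"
  by (simp add: subset_mean_def algebra_simps sum_distrib_left)

lemma subset_mean_diff: "subset_mean p S (\<lambda>A. f A - g A) = subset_mean p S f - subset_mean p S g"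
  by (simp add: subset_mean_def algebra_simps sum_subtractf)

lemma subset_mean_sum: "subset_mean p S (\<lambda>A. \<Sum>i\<in>I. f i A) = (\<Sum>i\<in>I. subset_mean p S (f i))"
  unfolding subset_mean_def by (subst sum.swap) (simp add: sum_distrib_left)

lemma subset_mean_mono:
  assumes "0 \<le> p" "p \<le> 1" "\<And>A. A \<subseteq> S \<Longrightarrow> f A \<le> g A"
  shows "subset_mean p S f \<le> subset_mean p S g"
  unfolding subset_mean_def using assms by (intro sum_mono mult_left_mono) auto

lemma subset_mean_const [simp]:
  assumes "finite S"
  shows "subset_mean p S (\<lambda>A. c) = c"
  using assms by induction (simp_all add: subset_mean_insert algebra_simps)

text \<open>
  Independence of the choices in disjoint sets, in the form of Fubini's theorem: the inner mean is the
  conditional expectation given the part of the random set inside \<open>S\<close>.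
\<close>
lemma subset_mean_Un:
  assumes "finite S" "finite T" "S \<inter> T = {}"
  shows "subset_mean p (S \<union> T) f = subset_mean p S (\<lambda>A. subset_mean p T (\<lambda>B. f (A \<union> B)))"
  using assms
proof (induction S arbitrary: f)
  case (insert e S)
  then show ?case by (simp add: subset_mean_insert)
qed simp

lemma subset_mean_superset:
  assumes "finite S" "X \<subseteq> S"
  shows "subset_mean p S (\<lambda>A. of_bool (X \<subseteq> A)) = p ^ card X"
  using assms
proof (induction S arbitrary: X)
  case (insert e S)
  show ?case
  proof (cases "e \<in> X")
    case True
    have "subset_mean p S (\<lambda>A. of_bool (X \<subseteq> A)) = subset_mean p S (\<lambda>A. 0)"
      using True insert.hyps by (intro subset_mean_cong) auto
    moreover have "X \<subseteq> insert e A \<longleftrightarrow> X - {e} \<subseteq> A" for A by auto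
    moreover have "card X = Suc (card (X - {e}))"
      using True insert.prems insert.hyps by (metis card.remove finite.insertI finite_subset)
    moreover have "subset_mean p S (\<lambda>A. of_bool (X - {e} \<subseteq> A)) = p ^ card (X - {e})"
      using insert.prems by (intro insert.IH) auto
    ultimately show ?thesis using insert.hyps by (simp add: subset_mean_insert)
  next
    case False
    then have "X \<subseteq> insert e A \<longleftrightarrow> X \<subseteq> A" for A by auto
    moreover have "subset_mean p S (\<lambda>A. of_bool (X \<subseteq> A)) = p ^ card X"
      using insert False by blast
    ultimately show ?thesis using insert.hyps by (simp add: subset_mean_insert algebra_simps)
  qed
qed simp

lemma subset_mean_member:
  assumes "finite S" "x \<in> S"
  shows "subset_mean p S (\<lambda>A. of_bool (x \<in> A)) = p"
  using subset_mean_superset[of S "{x}" p] assms by simp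

lemma subset_mean_card:
  assumes "finite S"
  shows "subset_mean p S (\<lambda>A. real (card A)) = p * real (card S)"
proof -
  have "subset_mean p S (\<lambda>A. real (card A)) = subset_mean p S (\<lambda>A. \<Sum>x\<in>S. of_bool (x \<in> A))"
    using assms by (intro subset_mean_cong) (simp add: of_bool_def sum.If_cases Int_absorb1)
  also have "\<dots> = p * real (card S)"
    unfolding subset_mean_sum using assms by (simp add: subset_mean_member)
  finally show ?thesis .
qed

lemma subset_mean_is_empty:
  assumes "finite S"
  shows "subset_mean p S (\<lambda>A. of_bool (A = {})) = (1 - p) ^ card S"
proof -
  have "subset_mean p S (\<lambda>A. of_bool (A = {})) = 
     (\<Sum>A\<in>{{}}. p ^ card A * (1 - p) ^ card (S - A) * of_bool (A = {}))"
    unfolding subset_mean_def using assms by (intro sum.mono_neutral_right) auto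
  then show ?thesis by simp
qed

text \<open>
  Decreasing functions of independent coin flips are positively correlated. In the induction step let \<open>f0\<close>, \<open>f1\<close>
  be the means of \<open>f\<close> given that the new element \<open>e\<close> is absent or present, and likewise \<open>g0\<close>, \<open>g1\<close>.
  The induction hypothesis handles the two conditional means, and mixing them only adds the covariance of the coin
  flip for \<open>e\<close>, which is \<open>p * (1 - p) * (f0 - f1) * (g0 - g1)\<close> and nonnegative since both differences are.
\<close>
lemma Harris_inequality:
  fixes f g :: "'a set \<Rightarrow> real"
  assumes "finite S" "0 \<le> p" "p \<le> 1" "antimono f" "antimono g"
  shows "subset_mean p S f * subset_mean p S g \<le> subset_mean p S (\<lambda>A. f A * g A)"
  using assms(1,4,5)
proof (induction S arbitrary: f g)
  case (insert e S)
  define f0 g0 f1 g1 where "f0 = subset_mean p S f" and "g0 = subset_mean p S g"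
    and "f1 = subset_mean p S (\<lambda>A. f (insert e A))" and "g1 = subset_mean p S (\<lambda>A. g (insert e A))"
  have anti: "antimono (\<lambda>A. f (insert e A))" "antimono (\<lambda>A. g (insert e A))"
    using insert.prems by (auto intro!: antimonoI elim!: antimonoD)
  have IH: "f0 * g0 \<le> subset_mean p S (\<lambda>A. f A * g A)"
    "f1 * g1 \<le> subset_mean p S (\<lambda>A. f (insert e A) * g (insert e A))"
    unfolding f0_def g0_def f1_def g1_def using insert.IH insert.prems anti by auto
  have "f1 \<le> f0" "g1 \<le> g0"
    unfolding f0_def g0_def f1_def g1_def using insert.prems assms(2,3)
    by (auto intro!: subset_mean_mono elim!: antimonoD)
  then have "0 \<le> p * (1 - p) * ((f0 - f1) * (g0 - g1))"
    using assms(2,3) by auto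
  then have "((1 - p) * f0 + p * f1) * ((1 - p) * g0 + p * g1)
      \<le> (1 - p) * (f0 * g0) + p * (f1 * g1)"
    by (simp add: algebra_simps)
  also have "\<dots> \<le> (1 - p) * subset_mean p S (\<lambda>A. f A * g A)
      + p * subset_mean p S (\<lambda>A. f (insert e A) * g (insert e A))"
    using IH assms(2,3) by (intro add_mono mult_left_mono) auto
  finally show ?case
    using insert.hyps by (simp add: subset_mean_insert f0_def g0_def f1_def g1_def)
qed simp

text \<open>
  The events that a given \<open>X\<close> is not contained in the random set are all decreasing, so Harris' inequality
  bounds the probability of their intersection by the product of their probabilities, as if they were
  independent. The sets in \<open>F\<close> may overlap.
\<close>
lemma subset_mean_avoid_all:
  assumes "finite S" "0 \<le> p" "p \<le> 1" "finite F" "\<And>X. X \<in> F \<Longrightarrow> X \<subseteq> S \<and> card X = k"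
  shows "(1 - p ^ k) ^ card F \<le> subset_mean p S (\<lambda>A. of_bool (\<forall>X\<in>F. \<not> X \<subseteq> A))"
  using assms(4,5)
proof (induction F)
  case empty
  then show ?case using assms(1) by simp
next
  case (insert X F)
  have "subset_mean p S (\<lambda>A. of_bool (\<not> X \<subseteq> A)) = subset_mean p S (\<lambda>A. 1 - of_bool (X \<subseteq> A))"
    by (intro subset_mean_cong) auto
  also have "\<dots> = 1 - p ^ k"
    using insert.prems assms(1) by (simp add: subset_mean_diff subset_mean_superset)
  finally have X: "subset_mean p S (\<lambda>A. of_bool (\<not> X \<subseteq> A)) = 1 - p ^ k" .
  have "(1 - p ^ k) ^ card (insert X F) \<le> subset_mean p S (\<lambda>A. of_bool (\<not> X \<subseteq> A))
      * subset_mean p S (\<lambda>A. of_bool (\<forall>X\<in>F. \<not> X \<subseteq> A))"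
    using insert assms(2,3) by (auto simp: X power_le_one intro!: mult_left_mono)
  also have "\<dots> \<le> subset_mean p S (\<lambda>A. of_bool (\<not> X \<subseteq> A) * of_bool (\<forall>X\<in>F. \<not> X \<subseteq> A))"
    using assms(1-3) by (intro Harris_inequality) (fastforce intro!: antimonoI)+
  finally show ?case by (simp flip: of_bool_conj)
qed

text \<open>
  The bridge to probability mass functions. The product measure lives on indicator functions that are
  \<open>False\<close> outside \<open>S\<close>, and these correspond to the subsets of \<open>S\<close>.
\<close>
lemma subset_mean_eq_expectation:
  assumes "finite S" "0 \<le> p" "p \<le> 1"
  shows "measure_pmf.expectation
      (map_pmf (\<lambda>r. {e \<in> S. r e}) (Pi_pmf S False (\<lambda>_. bernoulli_pmf p))) f = subset_mean p S f"
proof -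
  let ?P = "Pi_pmf S False (\<lambda>_. bernoulli_pmf p)"
  let ?ind = "\<lambda>A e. e \<in> A"
  have supp: "r \<in> ?ind ` Pow S" if "r \<in> set_pmf ?P" for r
  proof
    show "r = ?ind {e \<in> S. r e}"
      using that set_Pi_pmf_subset[OF \<open>finite S\<close>, of False "\<lambda>_. bernoulli_pmf p"] by (auto simp: fun_eq_iff)
  qed auto
  have "measure_pmf.expectation (map_pmf (\<lambda>r. {e \<in> S. r e}) ?P) f
      = (\<Sum>r\<in>?ind ` Pow S. f {e \<in> S. r e} * pmf ?P r)"
    using supp assms by (simp add: integral_measure_pmf_real)
  also have "\<dots> = (\<Sum>A\<in>Pow S. f {e \<in> S. e \<in> A} * pmf ?P (?ind A))"
    by (subst sum.reindex) (auto simp: inj_on_def fun_eq_iff)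
  also have "\<dots> = subset_mean p S f"
    unfolding subset_mean_def
  proof (intro sum.cong refl)
    fix A assume A: "A \<in> Pow S"
    have "pmf ?P (?ind A) = (\<Prod>e\<in>S. if e \<in> A then p else 1 - p)"
      using A assms by (subst pmf_Pi') (auto intro!: prod.cong)
    also have "\<dots> = p ^ card A * (1 - p) ^ card (S - A)"
      using A assms by (simp add: prod.If_cases Int_absorb1 Diff_eq)
    finally show "f {e \<in> S. e \<in> A} * pmf ?P (?ind A) = p ^ card A * (1 - p) ^ card (S - A) * f A"
      using A by (simp add: Int_absorb1 flip: Int_def)
  qed
  finally show ?thesis .
qed

section \<open>Pairs and triples of vertices\<close>

lemma real_choose_two: "real (m choose 2) = real m * (real m - 1) / 2"
  by (induction m) (auto simp: numeral_2_eq_2 field_simps)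

lemma bij_betw_insert_nsets:
  assumes "i \<in> V"
  shows "bij_betw (insert i) ([V - {i}]\<^bsup>k\<^esup>) {T \<in> [V]\<^bsup>Suc k\<^esup>. i \<in> T}"
proof (rule bij_betw_byWitness[where f' = "\<lambda>T. T - {i}"])
  show "insert i ` [V - {i}]\<^bsup>k\<^esup> \<subseteq> {T \<in> [V]\<^bsup>Suc k\<^esup>. i \<in> T}"
    using assms by (auto simp: nsets_def card_insert_if)
  show "(\<lambda>T. T - {i}) ` {T \<in> [V]\<^bsup>Suc k\<^esup>. i \<in> T} \<subseteq> [V - {i}]\<^bsup>k\<^esup>"
    using assms by (auto simp: nsets_def)
qed (auto simp: nsets_def)

lemma nsets_2_insert:
  assumes "i \<notin> P" "P \<in> [V]\<^bsup>2\<^esup>"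
  shows "[insert i P]\<^bsup>2\<^esup> = insert P ((\<lambda>j. {i, j}) ` P)"
proof -
  obtain x y where "P = {x, y}" "x \<noteq> y"
    using assms by (auto simp: nsets_2_eq)
  then show ?thesis using assms by (auto simp: nsets_2_eq)
qed

lemma triangle_edges:
  assumes "T \<in> [V]\<^bsup>3\<^esup>"
  shows "[T]\<^bsup>2\<^esup> \<subseteq> [V]\<^bsup>2\<^esup>" "card ([T]\<^bsup>2\<^esup>) = 3"
proof -
  have T: "T \<subseteq> V" "card T = 3"
    using assms by (auto simp: nsets_def)
  show "[T]\<^bsup>2\<^esup> \<subseteq> [V]\<^bsup>2\<^esup>"
    using T(1) by (rule nsets_mono)
  show "card ([T]\<^bsup>2\<^esup>) = 3"
    using T(2) by (simp add: choose_two)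
qed

lemma triangles_at_eq_sum:
  "triangles_at n E i = (\<Sum>T\<in>[{1..n}]\<^bsup>3\<^esup>. of_bool (i \<in> T \<and> [T]\<^bsup>2\<^esup> \<subseteq> E))"
proof -
  have "{T \<in> triangles n E. i \<in> T} = [{1..n}]\<^bsup>3\<^esup> \<inter> {T. i \<in> T \<and> [T]\<^bsup>2\<^esup> \<subseteq> E}"
    by (auto simp: triangles_def)
  then show ?thesis
    by (simp add: triangles_at_def of_bool_def sum.If_cases finite_imp_finite_nsets)
qed

text \<open>
  Used with \<open>k = 2\<close>: summing over the triangles at \<open>i\<close> is summing over the pairs of other vertices.
\<close>
lemma sum_nsets_containing:
  fixes f :: "'a set \<Rightarrow> real"
  assumes "finite V" "i \<in> V"
  shows "(\<Sum>T\<in>[V]\<^bsup>Suc k\<^esup>. of_bool (i \<in> T) * f T) = (\<Sum>P\<in>[V - {i}]\<^bsup>k\<^esup>. f (insert i P))"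
proof -
  have "(\<Sum>T\<in>[V]\<^bsup>Suc k\<^esup>. of_bool (i \<in> T) * f T) = (\<Sum>T\<in>{T \<in> [V]\<^bsup>Suc k\<^esup>. i \<in> T}. f T)"
    using assms by (intro sum.mono_neutral_cong_right) (auto simp: finite_imp_finite_nsets)
  also have "\<dots> = (\<Sum>P\<in>[V - {i}]\<^bsup>k\<^esup>. f (insert i P))"
    using sum.reindex_bij_betw[OF bij_betw_insert_nsets[OF assms(2)]] by metis
  finally show ?thesis .
qed

text \<open>
  A triple is a triangle exactly if its three pairs are all retained, which has probability \<open>p ^ 3\<close>.
\<close>
lemma mean_triangles_at:
  assumes "i \<in> {1..n}"
  shows "subset_mean p ([{1..n}]\<^bsup>2\<^esup>) (\<lambda>E. triangles_at n E i) = p ^ 3 * real ((n - 1) choose 2)"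
proof -
  have "subset_mean p ([{1..n}]\<^bsup>2\<^esup>) (\<lambda>E. triangles_at n E i)
      = (\<Sum>T\<in>[{1..n}]\<^bsup>3\<^esup>. subset_mean p ([{1..n}]\<^bsup>2\<^esup>) (\<lambda>E. of_bool (i \<in> T) * of_bool ([T]\<^bsup>2\<^esup> \<subseteq> E)))"
    by (simp add: triangles_at_eq_sum subset_mean_sum of_bool_conj)
  also have "\<dots> = (\<Sum>T\<in>[{1..n}]\<^bsup>3\<^esup>. of_bool (i \<in> T) * p ^ 3)"
  proof (intro sum.cong refl)
    fix T assume "T \<in> [{1..n}]\<^bsup>3\<^esup>"
    from triangle_edges[OF this] show "subset_mean p ([{1..n}]\<^bsup>2\<^esup>) (\<lambda>E. of_bool (i \<in> T) * of_bool ([T]\<^bsup>2\<^esup> \<subseteq> E))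
        = of_bool (i \<in> T) * p ^ 3"
      by (simp add: subset_mean_cmult subset_mean_superset finite_imp_finite_nsets)
  qed
  also have "\<dots> = (\<Sum>P\<in>[{1..n} - {i}]\<^bsup>2\<^esup>. p ^ 3)"
    using sum_nsets_containing[of "{1..n}" i "\<lambda>_. p ^ 3" 2] assms by (simp add: numeral_3_eq_3)
  also have "\<dots> = p ^ 3 * real ((n - 1) choose 2)"
    using assms by simp
  finally show ?thesis .
qed

section \<open>The triangle bias at a vertex given its neighbourhood\<close>

text \<open>
  The possible edges at \<open>i\<close>. Together with the pairs that avoid \<open>i\<close> they split the complete graph into two parts
  whose random choices are independent.
\<close>
definition star :: "nat \<Rightarrow> nat \<Rightarrow> graph" where
  "star n i = (\<lambda>j. {i, j}) ` ({1..n} - {i})"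

lemma finite_star [simp]: "finite (star n i)"
  by (simp add: star_def)

lemma inj_on_star: "inj_on (\<lambda>j. {i, j}) J"
  by (auto simp: inj_on_def doubleton_eq_iff)

lemma card_star:
  assumes "i \<in> {1..n}"
  shows "card (star n i) = n - 1"
  using assms by (simp add: star_def card_image inj_on_star)

lemma nsets_2_eq_star_Un:
  assumes "i \<in> {1..n}"
  shows "[{1..n}]\<^bsup>2\<^esup> = star n i \<union> [{1..n} - {i}]\<^bsup>2\<^esup>"
proof (intro equalityI subsetI)
  fix e assume "e \<in> [{1..n}]\<^bsup>2\<^esup>"
  then obtain x y where e: "e = {x, y}" "x \<noteq> y" "x \<in> {1..n}" "y \<in> {1..n}"
    by (elim nsets2_E)
  show "e \<in> star n i \<union> [{1..n} - {i}]\<^bsup>2\<^esup>"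
  proof (cases "i \<in> e")
    case True
    then have "e = {i, x} \<and> x \<noteq> i \<or> e = {i, y} \<and> y \<noteq> i"
      using e by auto
    then show ?thesis
      using e by (auto simp: star_def)
  next
    case False
    then show ?thesis
      using e by simp
  qed
next
  fix e assume "e \<in> star n i \<union> [{1..n} - {i}]\<^bsup>2\<^esup>"
  then show "e \<in> [{1..n}]\<^bsup>2\<^esup>"
    using assms nsets_mono[of "{1..n} - {i}" "{1..n}" 2] by (auto simp: star_def)
qed

lemma star_Int: "star n i \<inter> [{1..n} - {i}]\<^bsup>2\<^esup> = {}"
  by (auto simp: star_def)

text \<open>
  Throughout, \<open>A\<close> is the realised set of edges at \<open>i\<close>, so that the degree of \<open>i\<close> and its neighbourhood
  \<open>N\<close> are fixed, while \<open>B\<close> ranges over the possible sets of edges that avoid \<open>i\<close>.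
\<close>
context
  fixes n i :: nat and A :: graph and N :: "nat set"
  assumes i: "i \<in> {1..n}" and A: "A \<subseteq> star n i"
  defines "N \<equiv> {j \<in> {1..n}. {i, j} \<in> A}"
begin

lemma neighbours_subset: "N \<subseteq> {1..n} - {i}"
  using A by (auto simp: N_def star_def)

lemma finite_neighbours: "finite N"
  by (simp add: N_def)

lemma card_neighbours: "card N = card A"
proof -
  have "A = (\<lambda>j. {i, j}) ` N"
    using A by (auto simp: N_def star_def)
  then show ?thesis
    by (simp add: card_image inj_on_star)
qed

lemma adj_Un:
  assumes "B \<subseteq> [{1..n} - {i}]\<^bsup>2\<^esup>" "j \<in> {1..n}"
  shows "adj (A \<union> B) i j = of_bool (j \<in> N)"
  using assms by (auto simp: adj_def N_def)

lemma sum_adj: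
  assumes "B \<subseteq> [{1..n} - {i}]\<^bsup>2\<^esup>"
  shows "(\<Sum>j\<in>{1..n}. adj (A \<union> B) i j * f j) = (\<Sum>j\<in>N. f j)"
proof -
  have "(\<Sum>j\<in>{1..n}. adj (A \<union> B) i j * f j) = (\<Sum>j\<in>{1..n}. of_bool (j \<in> N) * f j)"
    using adj_Un[OF assms] by (intro sum.cong) auto
  also have "\<dots> = (\<Sum>j\<in>N. f j)"
    using neighbours_subset by (intro sum.mono_neutral_cong_right) auto
  finally show ?thesis .
qed

lemma deg_Un:
  assumes "B \<subseteq> [{1..n} - {i}]\<^bsup>2\<^esup>"
  shows "deg n (A \<union> B) i = real (card A)"
  using sum_adj[OF assms, of "\<lambda>_. 1"] by (simp add: deg_def card_neighbours)

lemma triangle_through_iff: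
  assumes "B \<subseteq> [{1..n} - {i}]\<^bsup>2\<^esup>" "P \<in> [{1..n} - {i}]\<^bsup>2\<^esup>"
  shows "[insert i P]\<^bsup>2\<^esup> \<subseteq> A \<union> B \<longleftrightarrow> P \<subseteq> N \<and> P \<in> B"
proof -
  have P: "i \<notin> P" "P \<subseteq> {1..n}" "P \<notin> A"
    using assms A by (auto simp: nsets_def star_def)
  have "{i, j} \<notin> B" for j
    using assms by auto
  then show ?thesis
    using P by (auto simp: nsets_2_insert[OF P(1) assms(2)] N_def)
qed

lemma triangle_avoiding_iff:
  assumes "T \<subseteq> {1..n} - {i}"
  shows "[T]\<^bsup>2\<^esup> \<subseteq> A \<union> B \<longleftrightarrow> [T]\<^bsup>2\<^esup> \<subseteq> B"
proof -
  have "[T]\<^bsup>2\<^esup> \<inter> A = {}"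
    using nsets_mono[OF assms, of 2] A star_Int[of n i] by blast
  then show ?thesis by blast
qed

text \<open>
  The triangles at \<open>i\<close> are the edges between two neighbours of \<open>i\<close>.
\<close>
lemma triangles_at_centre:
  assumes "B \<subseteq> [{1..n} - {i}]\<^bsup>2\<^esup>"
  shows "triangles_at n (A \<union> B) i = (\<Sum>P\<in>[N]\<^bsup>2\<^esup>. of_bool (P \<in> B))"
proof -
  have "triangles_at n (A \<union> B) i
      = (\<Sum>T\<in>[{1..n}]\<^bsup>Suc 2\<^esup>. of_bool (i \<in> T) * of_bool ([T]\<^bsup>2\<^esup> \<subseteq> A \<union> B))"
    unfolding triangles_at_eq_sum by (simp add: of_bool_conj)
  also have "\<dots> = (\<Sum>P\<in>[{1..n} - {i}]\<^bsup>2\<^esup>. of_bool ([insert i P]\<^bsup>2\<^esup> \<subseteq> A \<union> B))"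
    using i by (intro sum_nsets_containing) auto
  also have "\<dots> = (\<Sum>P\<in>[{1..n} - {i}]\<^bsup>2\<^esup>. of_bool (P \<subseteq> N \<and> P \<in> B))"
    using triangle_through_iff[OF assms] by (intro sum.cong) auto
  also have "\<dots> = (\<Sum>P\<in>[N]\<^bsup>2\<^esup>. of_bool (P \<in> B))"
    using neighbours_subset
    by (intro sum.mono_neutral_cong_right) (auto simp: finite_imp_finite_nsets nsets_def)
  finally show ?thesis .
qed

text \<open>
  A triangle through \<open>i\<close> has exactly two further vertices, both neighbours of \<open>i\<close>, so it is counted twice.
  The remaining triangles at the neighbours are triangles of \<open>B\<close> alone.
\<close>
lemma sum_triangles_at_neighbours:
  assumes "B \<subseteq> [{1..n} - {i}]\<^bsup>2\<^esup>"
  shows "(\<Sum>j\<in>N. triangles_at n (A \<union> B) j) = 2 * triangles_at n (A \<union> B) i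
    + (\<Sum>j\<in>N. \<Sum>T\<in>[{1..n} - {i}]\<^bsup>3\<^esup>. of_bool (j \<in> T) * of_bool ([T]\<^bsup>2\<^esup> \<subseteq> B))"
proof -
  let ?W = "{1..n} - {i}"
  let ?through = "\<lambda>j. \<Sum>P\<in>[?W]\<^bsup>2\<^esup>. of_bool (j \<in> P) * (of_bool (P \<subseteq> N \<and> P \<in> B) :: real)"
  let ?avoid = "\<lambda>j. \<Sum>T\<in>[?W]\<^bsup>3\<^esup>. of_bool (j \<in> T) * (of_bool ([T]\<^bsup>2\<^esup> \<subseteq> B) :: real)"
  have split: "triangles_at n (A \<union> B) j = ?through j + ?avoid j" if "j \<in> N" for j
  proof -
    have ji: "j \<noteq> i" using that neighbours_subset by auto
    let ?f = "\<lambda>T. of_bool (j \<in> T \<and> [T]\<^bsup>2\<^esup> \<subseteq> A \<union> B) :: real"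
    have "triangles_at n (A \<union> B) j
        = (\<Sum>T\<in>[{1..n}]\<^bsup>3\<^esup>. of_bool (i \<in> T) * ?f T + of_bool (i \<notin> T) * ?f T)"
      unfolding triangles_at_eq_sum by (intro sum.cong) auto
    also have "\<dots> = (\<Sum>T\<in>[{1..n}]\<^bsup>Suc 2\<^esup>. of_bool (i \<in> T) * ?f T)
        + (\<Sum>T\<in>[{1..n}]\<^bsup>3\<^esup>. of_bool (i \<notin> T) * ?f T)"
      by (simp only: sum.distrib) simp
    also have "(\<Sum>T\<in>[{1..n}]\<^bsup>Suc 2\<^esup>. of_bool (i \<in> T) * ?f T) = (\<Sum>P\<in>[?W]\<^bsup>2\<^esup>. ?f (insert i P))"
      using i by (intro sum_nsets_containing) auto
    also have "\<dots> = ?through j"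
      using triangle_through_iff[OF assms] ji by (intro sum.cong) auto
    also have "(\<Sum>T\<in>[{1..n}]\<^bsup>3\<^esup>. of_bool (i \<notin> T) * ?f T) = ?avoid j"
      using triangle_avoiding_iff[of _ B]
      by (intro sum.mono_neutral_cong_right) (auto simp: finite_imp_finite_nsets nsets_def)
    finally show ?thesis .
  qed
  have "(\<Sum>j\<in>N. ?through j) = (\<Sum>P\<in>[?W]\<^bsup>2\<^esup>. \<Sum>j\<in>N. of_bool (j \<in> P) * of_bool (P \<subseteq> N \<and> P \<in> B))"
    by (rule sum.swap)
  also have "\<dots> = (\<Sum>P\<in>[N]\<^bsup>2\<^esup>. 2 * of_bool (P \<in> B))"
  proof (intro sum.mono_neutral_cong_right ballI)
    fix P assume P: "P \<in> [N]\<^bsup>2\<^esup>"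
    then have "(\<Sum>j\<in>N. of_bool (j \<in> P) :: real) = 2"
      using finite_neighbours by (auto simp: of_bool_def sum.If_cases nsets_def Int_absorb1)
    then show "(\<Sum>j\<in>N. of_bool (j \<in> P) * of_bool (P \<subseteq> N \<and> P \<in> B)) = 2 * (of_bool (P \<in> B) :: real)"
      using P by (simp add: nsets_def flip: sum_distrib_right)
  qed (use neighbours_subset in \<open>auto simp: finite_imp_finite_nsets nsets_def\<close>)
  finally have "(\<Sum>j\<in>N. ?through j) = 2 * triangles_at n (A \<union> B) i"
    by (simp add: triangles_at_centre[OF assms] sum_distrib_left)
  then show ?thesis
    by (simp add: split sum.distrib)
qed

lemma mean_triangles_at_centre:
  "subset_mean p ([{1..n} - {i}]\<^bsup>2\<^esup>) (\<lambda>B. triangles_at n (A \<union> B) i) = p * real (card A choose 2)"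
proof -
  have "subset_mean p ([{1..n} - {i}]\<^bsup>2\<^esup>) (\<lambda>B. triangles_at n (A \<union> B) i)
      = subset_mean p ([{1..n} - {i}]\<^bsup>2\<^esup>) (\<lambda>B. \<Sum>P\<in>[N]\<^bsup>2\<^esup>. of_bool (P \<in> B))"
    by (intro subset_mean_cong triangles_at_centre)
  also have "\<dots> = (\<Sum>P\<in>[N]\<^bsup>2\<^esup>. p)"
    unfolding subset_mean_sum using nsets_mono[OF neighbours_subset, of 2]
    by (intro sum.cong subset_mean_member) (auto simp: finite_imp_finite_nsets)
  finally show ?thesis
    by (simp add: card_neighbours mult.commute)
qed

lemma mean_triangles_avoiding_centre:
  "subset_mean p ([{1..n} - {i}]\<^bsup>2\<^esup>)
      (\<lambda>B. \<Sum>j\<in>N. \<Sum>T\<in>[{1..n} - {i}]\<^bsup>3\<^esup>. of_bool (j \<in> T) * of_bool ([T]\<^bsup>2\<^esup> \<subseteq> B))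
    = real (card A) * (real ((n - 2) choose 2) * p ^ 3)"
proof -
  have "subset_mean p ([{1..n} - {i}]\<^bsup>2\<^esup>)
      (\<lambda>B. \<Sum>j\<in>N. \<Sum>T\<in>[{1..n} - {i}]\<^bsup>3\<^esup>. of_bool (j \<in> T) * of_bool ([T]\<^bsup>2\<^esup> \<subseteq> B))
      = (\<Sum>j\<in>N. \<Sum>T\<in>[{1..n} - {i}]\<^bsup>3\<^esup>. of_bool (j \<in> T) * p ^ 3)"
    unfolding subset_mean_sum subset_mean_cmult
  proof (intro sum.cong refl arg_cong2[where f = "(*)"])
    fix T assume "T \<in> [{1..n} - {i}]\<^bsup>3\<^esup>"
    from triangle_edges[OF this] show "subset_mean p ([{1..n} - {i}]\<^bsup>2\<^esup>) (\<lambda>B. of_bool ([T]\<^bsup>2\<^esup> \<subseteq> B)) = p ^ 3"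
      by (simp add: subset_mean_superset finite_imp_finite_nsets)
  qed
  also have "\<dots> = (\<Sum>j\<in>N. real ((n - 2) choose 2) * p ^ 3)"
  proof (intro sum.cong refl)
    fix j assume "j \<in> N"
    then have "card ({1..n} - {i} - {j}) = n - 2" "j \<in> {1..n} - {i}"
      using i neighbours_subset by (auto simp: card_Diff_singleton_if)
    then show "(\<Sum>T\<in>[{1..n} - {i}]\<^bsup>3\<^esup>. of_bool (j \<in> T) * p ^ 3) = real ((n - 2) choose 2) * p ^ 3"
      using sum_nsets_containing[of "{1..n} - {i}" j "\<lambda>_. p ^ 3" 2] by (simp add: numeral_3_eq_3)
  qed
  finally show ?thesis
    by (simp add: card_neighbours)
qed

text \<open>
  With \<open>d = card A\<close> positive, the average number of triangles at a neighbour has mean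
  \<open>(2 * p * (d choose 2) + d * c) / d = p * (d - 1) + c\<close>: the division by the degree cancels, and the result
  is affine in \<open>d\<close>. The term with \<open>A = {}\<close> turns this affine expression into the correct value \<open>0\<close> for an
  isolated vertex. The mean of the triangles at \<open>i\<close> stays unevaluated, because averaged over \<open>A\<close> it becomes
  a mean over the whole graph, which is already known.
\<close>
lemma mean_triangle_bias_at_given_star:
  fixes p :: real
  defines "c \<equiv> real ((n - 2) choose 2) * p ^ 3"
  shows "subset_mean p ([{1..n} - {i}]\<^bsup>2\<^esup>) (\<lambda>B. triangle_bias_at n (A \<union> B) i)
    = (p * real (card A) - p + c + (p - c) * of_bool (A = {}))
      - subset_mean p ([{1..n} - {i}]\<^bsup>2\<^esup>) (\<lambda>B. triangles_at n (A \<union> B) i)"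
proof -
  let ?R = "[{1..n} - {i}]\<^bsup>2\<^esup>"
  let ?s = "\<lambda>B. \<Sum>j\<in>N. \<Sum>T\<in>[{1..n} - {i}]\<^bsup>3\<^esup>. of_bool (j \<in> T) * (of_bool ([T]\<^bsup>2\<^esup> \<subseteq> B) :: real)"
  let ?d = "real (card A)"
  have fin: "finite A" using A finite_subset finite_star by blast
  have "subset_mean p ?R (\<lambda>B. triangle_bias_at n (A \<union> B) i)
      = subset_mean p ?R (\<lambda>B. (of_bool (?d \<noteq> 0) * 2 / ?d - of_bool (?d \<noteq> 0)) * triangles_at n (A \<union> B) i
          + of_bool (?d \<noteq> 0) / ?d * ?s B)"
    by (intro subset_mean_cong)
      (simp add: triangle_bias_at_def sum_adj deg_Un sum_triangles_at_neighbours algebra_simps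
        add_divide_distrib del: One_nat_def)
  also have "\<dots> = (of_bool (?d \<noteq> 0) * 2 / ?d - of_bool (?d \<noteq> 0)) * (p * real (card A choose 2))
      + of_bool (?d \<noteq> 0) / ?d * (?d * c)"
    by (simp only: subset_mean_add subset_mean_cmult mean_triangles_at_centre
        mean_triangles_avoiding_centre c_def)
  also have "\<dots> = (p * ?d - p + c + (p - c) * of_bool (A = {})) - p * real (card A choose 2)"
  proof (cases "A = {}")
    case False
    then have "?d \<noteq> 0" using fin by auto
    then show ?thesis
      unfolding real_choose_two using False by (simp add: field_simps)
  qed simp
  finally show ?thesis
    by (simp only: mean_triangles_at_centre)
qed

end

lemma mean_triangle_bias_at:
  fixes p :: real
  assumes "i \<in> {1..n}"
  defines "c \<equiv> real ((n - 2) choose 2) * p ^ 3"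
  shows "subset_mean p ([{1..n}]\<^bsup>2\<^esup>) (\<lambda>E. triangle_bias_at n E i)
    = p\<^sup>2 * real (n - 1) - p + c + (p - c) * (1 - p) ^ (n - 1) - p ^ 3 * real ((n - 1) choose 2)"
proof -
  let ?R = "[{1..n} - {i}]\<^bsup>2\<^esup>"
  have fubini: "subset_mean p ([{1..n}]\<^bsup>2\<^esup>) f
      = subset_mean p (star n i) (\<lambda>A. subset_mean p ?R (\<lambda>B. f (A \<union> B)))" for f
    unfolding nsets_2_eq_star_Un[OF assms(1)] using star_Int
    by (intro subset_mean_Un) (auto simp: finite_imp_finite_nsets)
  have "subset_mean p ([{1..n}]\<^bsup>2\<^esup>) (\<lambda>E. triangle_bias_at n E i)
      = subset_mean p (star n i) (\<lambda>A. (p * real (card A) - p + c + (p - c) * of_bool (A = {}))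
          - subset_mean p ?R (\<lambda>B. triangles_at n (A \<union> B) i))"
    unfolding fubini c_def
    by (intro subset_mean_cong mean_triangle_bias_at_given_star assms(1))
  also have "\<dots> = (p * (p * real (n - 1)) - p + c + (p - c) * (1 - p) ^ (n - 1))
      - subset_mean p ([{1..n}]\<^bsup>2\<^esup>) (\<lambda>E. triangles_at n E i)"
    unfolding fubini
    by (simp add: subset_mean_diff subset_mean_add subset_mean_cmult subset_mean_card
        subset_mean_is_empty card_star[OF assms(1)] del: One_nat_def)
  finally show ?thesis
    unfolding mean_triangles_at[OF assms(1)] by (simp add: power2_eq_square)
qed

section \<open>The expected triangle bias and its limit\<close>

lemma expectation_ERRG:
  assumes "0 \<le> p" "p \<le> 1"
  shows "measure_pmf.expectation (ERRG n p) f = subset_mean p ([{1..n}]\<^bsup>2\<^esup>) f"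
  unfolding ERRG_def using assms by (intro subset_mean_eq_expectation) (auto simp: finite_imp_finite_nsets)

lemma expectation_triangle_bias:
  assumes "0 \<le> p" "p \<le> 1" "3 \<le> n"
  shows "measure_pmf.expectation (ERRG n p) (triangle_bias n) =
    p * (1 - p) * (p * (real n - 2) - 1)
      + (p - p ^ 3 * (1 / 2) * (real n - 2) * (real n - 3)) * (1 - p) ^ (n - 1)"
proof -
  let ?c = "real ((n - 2) choose 2) * p ^ 3"
  let ?m = "p\<^sup>2 * real (n - 1) - p + ?c + (p - ?c) * (1 - p) ^ (n - 1) - p ^ 3 * real ((n - 1) choose 2)"
  have "measure_pmf.expectation (ERRG n p) (triangle_bias n)
      = 1 / real n * (\<Sum>i\<in>{1..n}. subset_mean p ([{1..n}]\<^bsup>2\<^esup>) (\<lambda>E. triangle_bias_at n E i))"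
    unfolding expectation_ERRG[OF assms(1,2)]
    by (simp only: triangle_bias_def[abs_def] subset_mean_cmult subset_mean_sum)
  also have "\<dots> = 1 / real n * (\<Sum>i\<in>{1..n}. ?m)"
    by (intro arg_cong2[where f = "(*)"] sum.cong mean_triangle_bias_at refl)
  also have "\<dots> = ?m"
    using assms by simp
  also have "\<dots> = p * (1 - p) * (p * (real n - 2) - 1)
      + (p - p ^ 3 * (1 / 2) * (real n - 2) * (real n - 3)) * (1 - p) ^ (n - 1)"
    using \<open>3 \<le> n\<close> by (simp add: real_choose_two of_nat_diff) (simp add: field_simps power2_eq_square power3_eq_cube)
  finally show ?thesis .
qed

lemma expectation_triangle_bias_limit:
  assumes "0 < l"
  shows "(\<lambda>n. measure_pmf.expectation (ERRG n (l / real n)) (\<lambda>E. real n * triangle_bias n E)) \<longlonglongrightarrow> zeta l"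
proof (rule Lim_transform_eventually)
  \<comment> \<open>The factor \<open>(1 - l / n) ^ (n - 1)\<close> is written as \<open>(1 - l / n) ^ n / (1 - l / n)\<close>, and the
    denominator goes into \<open>?b\<close>.\<close>
  let ?a = "\<lambda>n. real n * (l / real n * (1 - l / real n) * (l / real n * (real n - 2) - 1))"
  let ?b = "\<lambda>n. real n * (l / real n - (l / real n) ^ 3 * (1 / 2) * (real n - 2) * (real n - 3)) / (1 - l / real n)"
  have "?a \<longlonglongrightarrow> l ^ 2 - l"
    by (real_asymp simp: power2_eq_square algebra_simps)
  moreover have "?b \<longlonglongrightarrow> l - 1 / 2 * l ^ 3"
  proof (rule Lim_transform_eventually)
    have limits: "(\<lambda>n. (real n - 2) * (real n - 3) / real n ^ 2) \<longlonglongrightarrow> 1" "(\<lambda>n. 1 - l / real n) \<longlonglongrightarrow> 1"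
      by real_asymp+
    show "(\<lambda>n. (l - 1 / 2 * l ^ 3 * ((real n - 2) * (real n - 3) / real n ^ 2)) / (1 - l / real n))
        \<longlonglongrightarrow> l - 1 / 2 * l ^ 3"
      using tendsto_divide[OF tendsto_diff[OF tendsto_const
            tendsto_mult[OF tendsto_const limits(1)]] limits(2)] by (simp only: mult_1_right div_by_1)
    show "\<forall>\<^sub>F n in sequentially. (l - 1 / 2 * l ^ 3 * ((real n - 2) * (real n - 3) / real n ^ 2))
        / (1 - l / real n) = ?b n"
      using eventually_gt_at_top[of 0]
    proof eventually_elim
      case (elim n)
      have "x * (l / x - (l / x) ^ 3 * (1 / 2) * a * b) = l - 1 / 2 * l ^ 3 * (a * b / x ^ 2)"
        if "x \<noteq> 0" for x a b :: real
        using that by (simp add: field_simps power2_eq_square power3_eq_cube)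
      from this[of "real n"] show ?case
        using elim by simp
    qed
  qed
  moreover have "(\<lambda>n. (1 - l / real n) ^ n) \<longlonglongrightarrow> exp (- l)"
    using tendsto_exp_limit_sequentially[of "- l"] by simp
  ultimately show "(\<lambda>n. ?a n + ?b n * (1 - l / real n) ^ n) \<longlonglongrightarrow> zeta l"
    unfolding zeta_def by (intro tendsto_intros)
  obtain m where m: "l < real m"
    using reals_Archimedean2 by blast
  show "\<forall>\<^sub>F n in sequentially. ?a n + ?b n * (1 - l / real n) ^ n
      = measure_pmf.expectation (ERRG n (l / real n)) (\<lambda>E. real n * triangle_bias n E)"
    using eventually_ge_at_top[of "max 3 m"]
  proof eventually_elim
    case (elim n)
    then have n: "3 \<le> n" "l < real n"
      using m by auto
    then have p: "0 \<le> l / real n" "l / real n < 1"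
      using assms by auto
    have nz: "1 - l / real n \<noteq> 0"
      using p by linarith
    have "(1 - l / real n) ^ n = (1 - l / real n) * (1 - l / real n) ^ (n - 1)"
      using n by (simp add: power_eq_if)
    moreover have "u / y * (y * z) = u * z" if "y \<noteq> 0" for u y z :: real
      using that by simp
    from this[OF nz] have "?b n * ((1 - l / real n) * (1 - l / real n) ^ (n - 1))
        = real n * (l / real n - (l / real n) ^ 3 * (1 / 2) * (real n - 2) * (real n - 3))
          * (1 - l / real n) ^ (n - 1)"
      by (simp only: times_divide_eq_right)
    ultimately have "?b n * (1 - l / real n) ^ n
        = real n * (l / real n - (l / real n) ^ 3 * (1 / 2) * (real n - 2) * (real n - 3))
          * (1 - l / real n) ^ (n - 1)"
      by (simp only:)
    then show ?case
      using n p by (simp add: expectation_triangle_bias distrib_left mult.assoc)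
  qed
qed

section \<open>Triangle-free graphs and failure of the weak law\<close>

lemma triangle_bias_eq_0:
  assumes "triangles n E = {}"
  shows "triangle_bias n E = 0"
  using assms by (simp add: triangle_bias_def triangle_bias_at_def triangles_at_def)

text \<open>
  A triangle-free graph has bias \<open>0\<close>, and Harris' inequality bounds from below the probability that none of the
  \<open>n choose 3\<close> triples spans a triangle. A union bound would be useless once the expected number of
  triangles exceeds \<open>1\<close>, which happens for large \<open>p * n\<close>.
\<close>
lemma prob_bias_eq_0_ge:
  assumes "0 \<le> p" "p \<le> 1"
  shows "(1 - p ^ 3) ^ (n choose 3)
    \<le> measure_pmf.prob (ERRG n p) {E. real n * triangle_bias n E = 0}"
proof -
  let ?K = "[{1..n}]\<^bsup>2\<^esup>" and ?F = "(\<lambda>T. [T]\<^bsup>2\<^esup>) ` [{1..n}]\<^bsup>3\<^esup>"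
  let ?Z = "{E. real n * triangle_bias n E = 0}"
  have "(1 - p ^ 3) ^ (n choose 3) \<le> (1 - p ^ 3) ^ card ?F"
    using assms card_image_le[of "[{1..n}]\<^bsup>3\<^esup>" "\<lambda>T. [T]\<^bsup>2\<^esup>"]
    by (intro power_decreasing) (auto simp: finite_imp_finite_nsets power_le_one)
  also have "\<dots> \<le> subset_mean p ?K (\<lambda>E. of_bool (\<forall>X\<in>?F. \<not> X \<subseteq> E))"
  proof (rule subset_mean_avoid_all)
    fix X assume "X \<in> ?F"
    then show "X \<subseteq> ?K \<and> card X = 3"
      using triangle_edges by auto
  qed (use assms in \<open>auto simp: finite_imp_finite_nsets\<close>)
  also have "\<dots> \<le> subset_mean p ?K (indicator ?Z)"
  proof (rule subset_mean_mono[OF assms])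
    fix E
    show "of_bool (\<forall>X\<in>?F. \<not> X \<subseteq> E) \<le> (indicator ?Z E :: real)"
    proof (cases "\<forall>X\<in>?F. \<not> X \<subseteq> E")
      case True
      then have "triangles n E = {}" by (auto simp: triangles_def)
      then show ?thesis by (simp add: triangle_bias_eq_0)
    next
      case False
      then show ?thesis unfolding of_bool_def by (simp only: if_False indicator_pos_le)
    qed
  qed
  also have "\<dots> = measure_pmf.prob (ERRG n p) ?Z"
    using expectation_ERRG[OF assms, of n "indicator ?Z"] by simp
  finally show ?thesis .
qed

text \<open>
  The crude bound \<open>n choose 3 \<le> n ^ 3\<close> costs only a constant in the exponent and leads to the positive lower
  bound \<open>exp (- (l ^ 3))\<close>.
\<close>
lemma liminf_prob_bias_eq_0:
  assumes "0 < l"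
  shows "0 < liminf (\<lambda>n. ereal (measure_pmf.prob (ERRG n (l / real n)) {E. real n * triangle_bias n E = 0}))"
proof -
  have "(\<lambda>n. (1 - (l / real n) ^ 3) ^ (n ^ 3)) \<longlonglongrightarrow> exp (- (l ^ 3))"
  proof -
    have "filterlim (\<lambda>n::nat. n ^ 3) at_top at_top"
      by (intro filterlim_subseq) (auto simp: strict_mono_def power_strict_mono)
    from filterlim_compose[OF tendsto_exp_limit_sequentially[of "- (l ^ 3)"] this]
    show ?thesis by (simp add: power_divide)
  qed
  then have "0 < liminf (\<lambda>n. ereal ((1 - (l / real n) ^ 3) ^ (n ^ 3)))"
    by (subst lim_imp_Liminf[of _ _ "ereal (exp (- (l ^ 3)))"]) auto
  also have "\<dots> \<le> liminf (\<lambda>n. ereal (measure_pmf.prob (ERRG n (l / real n)) {E. real n * triangle_bias n E = 0}))"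
  proof (rule Liminf_mono)
    obtain m where m: "l < real m"
      using reals_Archimedean2 by blast
    show "\<forall>\<^sub>F n in sequentially. ereal ((1 - (l / real n) ^ 3) ^ (n ^ 3))
        \<le> ereal (measure_pmf.prob (ERRG n (l / real n)) {E. real n * triangle_bias n E = 0})"
      using eventually_ge_at_top[of "max 3 m"]
    proof eventually_elim
      case (elim n)
      then have p: "0 \<le> l / real n" "l / real n \<le> 1"
        using assms m by auto
      have "(1 - (l / real n) ^ 3) ^ (n ^ 3) \<le> (1 - (l / real n) ^ 3) ^ (n choose 3)"
        using p elim by (intro power_decreasing binomial_le_pow) (auto simp: power_le_one)
      also have "\<dots> \<le> measure_pmf.prob (ERRG n (l / real n)) {E. real n * triangle_bias n E = 0}"
        using p by (rule prob_bias_eq_0_ge)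
      finally show ?case by simp
    qed
  qed
  finally show ?thesis .
qed

text \<open>
  Positivity matters since a limit equal to \<open>0\<close> would be compatible with the atom at \<open>0\<close>. Write
  \<open>zeta l = l * g l\<close> with \<open>g x = x - 1 + (1 - x\<^sup>2 / 2) * exp (- x)\<close>. Then \<open>g 0 = 0\<close>, and \<open>g\<close> is strictly
  increasing because \<open>1 + x - x\<^sup>2 / 2 < 1 + x \<le> exp x\<close>.
\<close>
lemma zeta_pos:
  assumes "0 < l"
  shows "0 < zeta l"
proof -
  define g where "g x = x - 1 + (1 - x ^ 2 / 2) * exp (- x)" for x :: real
  have "g 0 < g l"
  proof (rule DERIV_pos_imp_increasing_open[OF assms])
    fix x :: real assume x: "0 < x" "x < l"
    have "(g has_real_derivative 1 - (1 + x - x ^ 2 / 2) * exp (- x)) (at x)"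
      unfolding g_def by (auto intro!: derivative_eq_intros simp: algebra_simps diff_divide_distrib)
    moreover have "(1 + x - x ^ 2 / 2) * exp (- x) < 1"
    proof -
      have "1 + x - x ^ 2 / 2 < 1 + x" using x by simp
      also have "\<dots> \<le> exp x" by (rule exp_ge_add_one_self)
      finally show ?thesis by (simp add: exp_minus field_simps)
    qed
    ultimately show "\<exists>y. (g has_real_derivative y) (at x) \<and> 0 < y"
      by (intro exI[of _ "1 - (1 + x - x ^ 2 / 2) * exp (- x)"]) simp
  qed (auto simp: g_def intro!: continuous_intros)
  moreover have "zeta l = l * g l"
    by (simp add: zeta_def g_def algebra_simps power2_eq_square power3_eq_cube)
  ultimately show ?thesis
    using assms by (simp add: g_def)
qed

text \<open>
  A nonvanishing atom at \<open>0\<close> stays at distance \<open>c\<close> from the proposed limit, so the tolerance \<open>c / 2\<close> separates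
  the two.
\<close>
lemma not_converges_in_prob:
  assumes "0 < c" "0 < liminf (\<lambda>n. ereal (measure_pmf.prob (M n) {x. X n x = 0}))"
  shows "\<not> converges_in_prob M X c"
proof
  assume "converges_in_prob M X c"
  then have lim: "(\<lambda>n. measure_pmf.prob (M n) {x. \<bar>X n x - c\<bar> > c / 2}) \<longlonglongrightarrow> 0"
    using half_gt_zero[OF assms(1)] unfolding converges_in_prob_def by blast
  have subset: "{x. X n x = 0} \<subseteq> {x. \<bar>X n x - c\<bar> > c / 2}" for n
    using assms(1) by auto
  have "(\<lambda>n. measure_pmf.prob (M n) {x. X n x = 0}) \<longlonglongrightarrow> 0"
  proof (rule tendsto_sandwich[OF _ _ tendsto_const lim])
    show "\<forall>\<^sub>F n in sequentially. measure_pmf.prob (M n) {x. X n x = 0}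
        \<le> measure_pmf.prob (M n) {x. \<bar>X n x - c\<bar> > c / 2}"
      using measure_pmf.finite_measure_mono[OF subset] by (intro always_eventually allI) simp
  qed simp
  then have "liminf (\<lambda>n. ereal (measure_pmf.prob (M n) {x. X n x = 0})) = ereal 0"
    by (intro lim_imp_Liminf) (simp_all only: tendsto_ereal trivial_limit_sequentially not_False_eq_True)
  then show False
    using assms(2) by simp
qed

theorem theorem4:
  shows "(\<forall>(l::real) (n::nat). 0 < l \<longrightarrow> 3 \<le> n \<longrightarrow> l \<le> real n \<longrightarrow>
           measure_pmf.expectation (ERRG n (l / real n)) (triangle_bias n) =
             l / real n * (1 - l / real n) * (l / real n * (real n - 2) - 1)
             + (l / real n - (l / real n) ^ 3 * (1 / 2) * (real n - 2) * (real n - 3))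
               * (1 - l / real n) ^ (n - 1))
       \<and> (\<forall>l::real. 0 < l \<longrightarrow>
           (\<lambda>n. measure_pmf.expectation (ERRG n (l / real n)) (\<lambda>E. real n * triangle_bias n E))
             \<longlonglongrightarrow> zeta l)
       \<and> (\<forall>l::real. 0 < l \<longrightarrow>
           0 < liminf (\<lambda>n. ereal (measure_pmf.prob (ERRG n (l / real n))
                                    {E. real n * triangle_bias n E = 0}))
           \<and> \<not> converges_in_prob (\<lambda>n. ERRG n (l / real n)) (\<lambda>n E. real n * triangle_bias n E) (zeta l))"
proof (intro conjI allI impI)
  fix l :: real and n :: nat
  assume "0 < l" "3 \<le> n" "l \<le> real n"
  then show "measure_pmf.expectation (ERRG n (l / real n)) (triangle_bias n) =
      l / real n * (1 - l / real n) * (l / real n * (real n - 2) - 1)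
      + (l / real n - (l / real n) ^ 3 * (1 / 2) * (real n - 2) * (real n - 3))
        * (1 - l / real n) ^ (n - 1)"
    by (intro expectation_triangle_bias) auto
next
  fix l :: real
  assume "0 < l"
  then show "(\<lambda>n. measure_pmf.expectation (ERRG n (l / real n)) (\<lambda>E. real n * triangle_bias n E))
      \<longlonglongrightarrow> zeta l"
    by (rule expectation_triangle_bias_limit)
  show "0 < liminf (\<lambda>n. ereal (measure_pmf.prob (ERRG n (l / real n))
      {E. real n * triangle_bias n E = 0}))"
    using \<open>0 < l\<close> by (rule liminf_prob_bias_eq_0)
  with zeta_pos[OF \<open>0 < l\<close>]
  show "\<not> converges_in_prob (\<lambda>n. ERRG n (l / real n)) (\<lambda>n E. real n * triangle_bias n E) (zeta l)"
    by (rule not_converges_in_prob)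
qed

end
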